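(* Let $A=\begin{pmatrix} a & b\\ b & c\end{pmatrix}$ be a doubly nonnegative matrix with nonnegative integer entries and $a\le 64$. Then $A=BB^T$ for some $2\times 9$ matrix $B$ with nonnegative integer entries.
   Context: A matrix is doubly nonnegative if it is symmetric positive semidefinite and entrywise nonnegative. *)

theory Defs
  imports "HOL-Analysis.Analysis"
begin

definition positive_semidefinite :: "real ^ 'n ^ 'n \<Rightarrow> bool" where
  "positive_semidefinite A \<longleftrightarrow> transpose A = A \<and> (\<forall>x. 0 \<le> x \<bullet> (A *v x))"

definition doubly_nonnegative :: "real ^ 'n ^ 'n \<Rightarrow> bool" where
  "doubly_nonnegative A \<longleftrightarrow> positive_semidefinite A \<and> (\<forall>i j. 0 \<le> A $ i $ j)"

text \<open>The set \<open>\<nat>\<close> of naturals inside the reals contains 0, so these are the matrices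
  with nonnegative integer entries.\<close>

definition nonneg_integer_matrix :: "real ^ 'n ^ 'm \<Rightarrow> bool" where
  "nonneg_integer_matrix A \<longleftrightarrow> (\<forall>i j. A $ i $ j \<in> \<nat>)"

end

theory Submission
  imports Defs "HOL-Computational_Algebra.Primes"
begin

text \<open>
  Write the rows of \<open>B\<close> as \<open>u\<close> and \<open>v\<close>.  Replacing \<open>v\<close> by \<open>v - u\<close> and swapping the rows reduces
  to \<open>b < a \<le> c\<close>.  In that case \<open>u\<close> and \<open>v\<close> are first chosen in five coordinates with \<open>|u|\<^sup>2 = a\<close>,
  \<open>u \<bullet> v = b\<close> and \<open>|v|\<^sup>2 \<le> a\<close>; the four remaining coordinates of \<open>u\<close> are zero, and those of \<open>v\<close>
  supply the missing \<open>c - |v|\<^sup>2 \<ge> 0\<close> by Lagrange's four-square theorem.  For \<open>a \<le> 64\<close> and \<open>a \<noteq> 33\<close>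
  one \<open>u\<close> serves all \<open>b < a\<close>.
\<close>

section \<open>Sums of four squares\<close>

definition four_squares :: "int \<Rightarrow> bool" where
  "four_squares n \<longleftrightarrow> (\<exists>w x y z. n = w\<^sup>2 + x\<^sup>2 + y\<^sup>2 + z\<^sup>2)"

text \<open>Euler's four-square identity: multiplying one quaternion by the conjugate of another
  multiplies their norms.\<close>

lemma four_squares_mult:
  assumes "four_squares m" "four_squares n"
  shows "four_squares (m * n)"
proof -
  from assms obtain a b c d w x y z where m: "m = a\<^sup>2 + b\<^sup>2 + c\<^sup>2 + d\<^sup>2"
    and n: "n = w\<^sup>2 + x\<^sup>2 + y\<^sup>2 + z\<^sup>2"
    unfolding four_squares_def by blast
  have "m * n = (a*w + b*x + c*y + d*z)\<^sup>2 + (a*x - b*w + c*z - d*y)\<^sup>2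
      + (a*y - c*w + d*x - b*z)\<^sup>2 + (a*z - d*w + b*y - c*x)\<^sup>2"
    unfolding m n by algebra
  then show ?thesis unfolding four_squares_def by blast
qed

text \<open>Both factors of \<open>(x - y) * (x + y)\<close> are smaller than \<open>p\<close> in
  absolute value, so the one that \<open>p\<close> divides vanishes.\<close>

lemma inj_on_square_mod_prime:
  assumes p: "prime (int p)"
  shows "inj_on (\<lambda>x. (int x)\<^sup>2 mod int p) {x. 2 * x < p}"
proof (rule inj_onI)
  fix x y
  assume x: "x \<in> {x. 2 * x < p}" and y: "y \<in> {x. 2 * x < p}"
    and eq: "(int x)\<^sup>2 mod int p = (int y)\<^sup>2 mod int p"
  from eq have "int p dvd (int x)\<^sup>2 - (int y)\<^sup>2"
    by (simp add: mod_eq_dvd_iff)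
  then have "int p dvd (int x - int y) * (int x + int y)"
    by (simp add: power2_eq_square algebra_simps)
  then consider "int p dvd int x - int y" | "int p dvd int x + int y"
    using p by (auto simp: prime_dvd_mult_iff)
  then show "x = y"
  proof cases
    case 1
    then have "int x - int y = 0"
      using x y dvd_imp_le_int[of "int x - int y" "int p"] by fastforce
    then show ?thesis by simp
  next
    case 2
    then have "int x + int y = 0"
      using x y by (auto dest: zdvd_imp_le)
    then show ?thesis by simp
  qed
qed

text \<open>Pigeonhole: on the \<open>(p + 1) / 2\<close> naturals below \<open>p / 2\<close>, both
  \<open>x^2\<close> and \<open>-1 - y^2\<close> are injective modulo \<open>p\<close>. Together
  they take \<open>p + 1\<close> values, so some residue is shared.\<close>

lemma prime_dvd_two_squares_plus_one:
  assumes p: "prime p" "odd p"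
  obtains x y :: nat where "2 * x < p" "2 * y < p" "p dvd x\<^sup>2 + y\<^sup>2 + 1"
proof -
  let ?H = "{x. 2 * x < p}"
  let ?f = "\<lambda>x. (int x)\<^sup>2 mod int p"
  let ?g = "\<lambda>y. (- 1 - (int y)\<^sup>2) mod int p"
  have p': "prime (int p)" using p by simp
  have p0: "0 < int p" using p prime_gt_0_nat by simp
  obtain h where h: "p = 2 * h + 1" using p(2) by (rule oddE)
  have H: "?H = {..h}" unfolding h by auto
  have f: "inj_on ?f ?H" by (rule inj_on_square_mod_prime[OF p'])
  have g: "inj_on ?g ?H"
  proof (rule inj_onI)
    fix x y assume xy: "x \<in> ?H" "y \<in> ?H" and "?g x = ?g y"
    then have "int p dvd (- 1 - (int x)\<^sup>2) - (- 1 - (int y)\<^sup>2)"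
      by (simp only: mod_eq_dvd_iff)
    then have "int p dvd (int y)\<^sup>2 - (int x)\<^sup>2" by simp
    then have "?f y = ?f x" by (simp only: mod_eq_dvd_iff)
    with f xy show "x = y" by (auto dest: inj_onD)
  qed
  have "?f ` ?H \<inter> ?g ` ?H \<noteq> {}"
  proof
    assume "?f ` ?H \<inter> ?g ` ?H = {}"
    then have "card (?f ` ?H \<union> ?g ` ?H) = card (?f ` ?H) + card (?g ` ?H)"
      unfolding H by (intro card_Un_disjoint) auto
    also have "\<dots> = (h + 1) + (h + 1)"
      using card_image[OF f] card_image[OF g] unfolding H by simp
    also have "\<dots> = p + 1" using h by simp
    finally have "card (?f ` ?H \<union> ?g ` ?H) = p + 1" .
    moreover have "card (?f ` ?H \<union> ?g ` ?H) \<le> card {0..<int p}"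
      using p0 by (intro card_mono) auto
    ultimately show False by simp
  qed
  then obtain x y where xy: "2 * x < p" "2 * y < p" and "?f x = ?g y" by fastforce
  then have "int p dvd (int x)\<^sup>2 - (- 1 - (int y)\<^sup>2)" by (simp only: mod_eq_dvd_iff)
  then have "int p dvd int (x\<^sup>2 + y\<^sup>2 + 1)" by (simp add: algebra_simps)
  then have "p dvd x\<^sup>2 + y\<^sup>2 + 1" by (simp only: int_dvd_int_iff)
  with xy show ?thesis by (rule that)
qed

lemma symmetric_residue:
  fixes x m :: int
  assumes "0 < m"
  obtains y t where "x = y + m * t" "\<bar>2 * y\<bar> \<le> m"
proof
  \<comment> \<open>The floor of \<open>x / m + 1 / 2\<close>, that is, \<open>x / m\<close> rounded
    to a nearest integer.\<close>
  let ?t = "(2 * x + m) div (2 * m)"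
  show "x = (x - m * ?t) + m * ?t" by simp
  have "(2 * x + m) = 2 * m * ?t + (2 * x + m) mod (2 * m)" by simp
  moreover have "0 \<le> (2 * x + m) mod (2 * m)" "(2 * x + m) mod (2 * m) < 2 * m"
    using assms by simp_all
  ultimately show "\<bar>2 * (x - m * ?t)\<bar> \<le> m" by (simp add: algebra_simps abs_le_iff)
qed

text \<open>Lagrange's descent: reduce the four roots modulo \<open>m\<close> to absolutely least
  residues, whose squares sum to \<open>m * r\<close> with \<open>r <= m\<close>. Euler's identity
  for the two sums gives four terms divisible by \<open>m\<close>; dividing by \<open>m^2\<close>
  leaves \<open>r * p\<close>. The extremes \<open>r = 0\<close> and \<open>r = m\<close> would
  force \<open>m dvd p\<close>.\<close>

lemma four_squares_descent:
  fixes m p :: int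
  assumes m: "1 < m" "\<not> m dvd p" and sq: "four_squares (m * p)"
  obtains r where "0 < r" "r < m" "four_squares (r * p)"
proof -
  from sq obtain x1 x2 x3 x4 where x: "m * p = x1\<^sup>2 + x2\<^sup>2 + x3\<^sup>2 + x4\<^sup>2"
    unfolding four_squares_def by blast
  have m0: "0 < m" using m by simp
  obtain y1 t1 where 1: "x1 = y1 + m * t1" "\<bar>2 * y1\<bar> \<le> m" using symmetric_residue[OF m0] .
  obtain y2 t2 where 2: "x2 = y2 + m * t2" "\<bar>2 * y2\<bar> \<le> m" using symmetric_residue[OF m0] .
  obtain y3 t3 where 3: "x3 = y3 + m * t3" "\<bar>2 * y3\<bar> \<le> m" using symmetric_residue[OF m0] .
  obtain y4 t4 where 4: "x4 = y4 + m * t4" "\<bar>2 * y4\<bar> \<le> m" using symmetric_residue[OF m0] .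
  define s where "s = y1\<^sup>2 + y2\<^sup>2 + y3\<^sup>2 + y4\<^sup>2"
  define r where "r = p - 2 * (y1*t1 + y2*t2 + y3*t3 + y4*t4) - m * (t1\<^sup>2 + t2\<^sup>2 + t3\<^sup>2 + t4\<^sup>2)"
  have s: "s = m * r"
    using x unfolding s_def r_def 1 2 3 4 by algebra
  have le: "4 * y\<^sup>2 \<le> m\<^sup>2" if "\<bar>2 * y\<bar> \<le> m" for y
    using power_mono[OF that, of 2] by simp
  have bounds: "4 * y1\<^sup>2 \<le> m\<^sup>2" "4 * y2\<^sup>2 \<le> m\<^sup>2" "4 * y3\<^sup>2 \<le> m\<^sup>2" "4 * y4\<^sup>2 \<le> m\<^sup>2"
    using 1 2 3 4 le by blast+
  have "0 \<le> s" unfolding s_def by simp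
  then have r0: "0 \<le> r" using s m0 by (simp add: zero_le_mult_iff)
  have "m * r \<le> m * m"
    using bounds s unfolding s_def by (simp add: power2_eq_square)
  then have rm: "r \<le> m" using m0 by simp
  have "r \<noteq> 0"
  proof
    assume "r = 0"
    then have "y1\<^sup>2 + y2\<^sup>2 + y3\<^sup>2 + y4\<^sup>2 = 0" using s s_def by simp
    then have "y1 = 0" "y2 = 0" "y3 = 0" "y4 = 0"
      by (smt (verit) zero_le_power2 power2_less_eq_zero_iff)+
    then have "p = m * (t1\<^sup>2 + t2\<^sup>2 + t3\<^sup>2 + t4\<^sup>2)" using \<open>r = 0\<close> unfolding r_def by simp
    then show False using m by simp
  qed
  \<comment> \<open>Equality in all four bounds makes each \<open>y_i\<close> equal to
    \<open>m / 2\<close> up to sign, so \<open>m\<close> divides every \<open>2 * y_i\<close> and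
    hence \<open>p\<close>.\<close>
  moreover have "r \<noteq> m"
  proof
    assume r: "r = m"
    have "4 * y1\<^sup>2 = m\<^sup>2" "4 * y2\<^sup>2 = m\<^sup>2" "4 * y3\<^sup>2 = m\<^sup>2" "4 * y4\<^sup>2 = m\<^sup>2"
      using bounds s r unfolding s_def by (simp_all add: power2_eq_square)
    moreover have "m dvd 2 * y" if "4 * y\<^sup>2 = m\<^sup>2" for y
    proof -
      have "(2 * y)\<^sup>2 = m\<^sup>2" using that by simp
      then have "2 * y = m \<or> 2 * y = - m" by (simp only: power2_eq_iff)
      then show ?thesis by (elim disjE) simp_all
    qed
    ultimately have "m dvd 2 * y1" "m dvd 2 * y2" "m dvd 2 * y3" "m dvd 2 * y4"
      by blast+
    then have "m dvd 2 * y1 * t1 + 2 * y2 * t2 + 2 * y3 * t3 + 2 * y4 * t4"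
      by (intro dvd_add; blast intro: dvd_mult2)
    moreover have "p = (2 * y1 * t1 + 2 * y2 * t2 + 2 * y3 * t3 + 2 * y4 * t4)
        + m * (1 + t1\<^sup>2 + t2\<^sup>2 + t3\<^sup>2 + t4\<^sup>2)"
      using r unfolding r_def by (simp add: algebra_simps)
    ultimately show False using m by (metis dvd_add dvd_triv_left)
  qed
  moreover have "four_squares (r * p)"
  proof -
    \<comment> \<open>Up to sign, the Euler terms for \<open>x_i\<close> and
      \<open>y_i = x_i - m * t_i\<close> divided by \<open>m\<close>: mixed products
      \<open>x_i * x_j\<close> cancel, and the squares in the first term sum to
      \<open>m * p\<close>.\<close>
    let ?A = "p - (x1*t1 + x2*t2 + x3*t3 + x4*t4)"
    let ?B = "x1*t2 - x2*t1 + x3*t4 - x4*t3"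
    let ?C = "x1*t3 - x3*t1 + x4*t2 - x2*t4"
    let ?D = "x1*t4 - x4*t1 + x2*t3 - x3*t2"
    have y: "y1 = x1 - m * t1" "y2 = x2 - m * t2" "y3 = x3 - m * t3" "y4 = x4 - m * t4"
      using 1 2 3 4 by simp_all
    have A: "x1*y1 + x2*y2 + x3*y3 + x4*y4 = m * ?A" using x unfolding y by algebra
    have B: "x1*y2 - x2*y1 + x3*y4 - x4*y3 = - m * ?B" unfolding y by algebra
    have C: "x1*y3 - x3*y1 + x4*y2 - x2*y4 = - m * ?C" unfolding y by algebra
    have D: "x1*y4 - x4*y1 + x2*y3 - x3*y2 = - m * ?D" unfolding y by algebra
    have "(m * p) * (m * r) = (x1\<^sup>2 + x2\<^sup>2 + x3\<^sup>2 + x4\<^sup>2) * (y1\<^sup>2 + y2\<^sup>2 + y3\<^sup>2 + y4\<^sup>2)"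
      using s s_def x by simp
    also have "\<dots> = (x1*y1 + x2*y2 + x3*y3 + x4*y4)\<^sup>2 + (x1*y2 - x2*y1 + x3*y4 - x4*y3)\<^sup>2
      + (x1*y3 - x3*y1 + x4*y2 - x2*y4)\<^sup>2 + (x1*y4 - x4*y1 + x2*y3 - x3*y2)\<^sup>2"
      by algebra
    also have "\<dots> = m\<^sup>2 * (?A\<^sup>2 + ?B\<^sup>2 + ?C\<^sup>2 + ?D\<^sup>2)"
      unfolding A B C D by (simp only: power_mult_distrib power2_minus distrib_left)
    finally have "m\<^sup>2 * (r * p) = m\<^sup>2 * (?A\<^sup>2 + ?B\<^sup>2 + ?C\<^sup>2 + ?D\<^sup>2)"
      by (simp add: power2_eq_square mult_ac)
    then have "r * p = ?A\<^sup>2 + ?B\<^sup>2 + ?C\<^sup>2 + ?D\<^sup>2" using m0 by simp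
    then show ?thesis unfolding four_squares_def by blast
  qed
  ultimately show ?thesis using r0 rm by (intro that[of r]) auto
qed

text \<open>The descent is repeated until the factor is 1; a factor strictly between 1 and the prime
  \<open>p\<close> cannot divide \<open>p\<close>.\<close>

lemma four_squares_prime_of_multiple:
  assumes p: "prime p" and "0 < m" "m < p" "four_squares (int m * int p)"
  shows "four_squares (int p)"
  using assms(2-)
proof (induction m rule: less_induct)
  case (less m)
  show ?case
  proof (cases "m = 1")
    case True
    then show ?thesis using less.prems by simp
  next
    case False
    then have "1 < int m" using less.prems by simp
    moreover have "\<not> int m dvd int p"
      using p False less.prems by (simp add: prime_nat_iff) blast
    ultimately obtain r where r: "0 < r" "r < int m" "four_squares (r * int p)"
      using four_squares_descent less.prems by blast
    then show ?thesis using less.IH[of "nat r"] less.prems by simp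
  qed
qed

lemma four_squares_prime:
  assumes "prime p"
  shows "four_squares (int p)"
proof (cases "p = 2")
  case True
  have "2 = (1::int)\<^sup>2 + 1\<^sup>2 + 0\<^sup>2 + 0\<^sup>2" by simp
  then show ?thesis unfolding four_squares_def True by (metis of_nat_numeral)
next
  case False
  then have "odd p" using assms prime_odd_nat[of p] prime_ge_2_nat[of p] by linarith
  then obtain x y where xy: "2 * x < p" "2 * y < p" "p dvd x\<^sup>2 + y\<^sup>2 + 1"
    using prime_dvd_two_squares_plus_one assms by blast
  then obtain m where m: "x\<^sup>2 + y\<^sup>2 + 1 = p * m" by blast
  have "4 * x\<^sup>2 < p\<^sup>2" "4 * y\<^sup>2 < p\<^sup>2"
    using power_strict_mono[OF xy(1), of 2] power_strict_mono[OF xy(2), of 2] by simp_all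
  \<comment> \<open>The bounds add up to \<open>4 * (x^2 + y^2 + 1) < 3 * p^2\<close>, which makes
    the cofactor \<open>m\<close> smaller than \<open>p\<close>.\<close>
  moreover have "2\<^sup>2 \<le> p\<^sup>2" using prime_ge_2_nat[OF assms] by (intro power_mono) auto
  ultimately have "p * m < p * p" using m unfolding power2_eq_square by linarith
  then have "m < p" by simp
  moreover have "0 < m" using m by (cases m) auto
  moreover have "int m * int p = (int x)\<^sup>2 + (int y)\<^sup>2 + 1\<^sup>2 + 0\<^sup>2"
    using arg_cong[OF m, of int] by (simp add: mult.commute)
  then have "four_squares (int m * int p)" unfolding four_squares_def by blast
  ultimately show ?thesis using four_squares_prime_of_multiple assms by blast
qed

theorem lagrange_four_squares:
  fixes n :: nat
  obtains w x y z :: nat where "n = w\<^sup>2 + x\<^sup>2 + y\<^sup>2 + z\<^sup>2"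
proof -
  have "four_squares (int n)"
  proof (induction n rule: less_induct)
    case (less n)
    have "(0::int) = 0\<^sup>2 + 0\<^sup>2 + 0\<^sup>2 + 0\<^sup>2" "(1::int) = 1\<^sup>2 + 0\<^sup>2 + 0\<^sup>2 + 0\<^sup>2" by simp_all
    then have base: "four_squares 0" "four_squares 1"
      unfolding four_squares_def by blast+
    show ?case
    proof (cases "n = 0 \<or> n = 1")
      case True
      then show ?thesis using base by auto
    next
      case False
      then obtain p where p: "prime p" "p dvd n" using prime_factor_nat by blast
      then obtain k where k: "n = p * k" by blast
      then have "k < n" using False p prime_gt_1_nat[of p] by simp
      then show ?thesis
        using four_squares_mult[OF four_squares_prime[OF p(1)] less.IH] k by simp
    qed
  qed
  then obtain w x y z where "int n = w\<^sup>2 + x\<^sup>2 + y\<^sup>2 + z\<^sup>2"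
    unfolding four_squares_def by blast
  then have "int n = int ((nat \<bar>w\<bar>)\<^sup>2 + (nat \<bar>x\<bar>)\<^sup>2 + (nat \<bar>y\<bar>)\<^sup>2 + (nat \<bar>z\<bar>)\<^sup>2)" by simp
  then show ?thesis using that by (simp only: of_nat_eq_iff)
qed

section \<open>Pairs of nonnegative integer vectors with a prescribed Gram matrix\<close>

text \<open>Vectors are functions read only below \<open>k\<close>, so the dimension can vary and a
  coordinate is appended by a function update.\<close>

definition is_gram :: "nat \<Rightarrow> nat \<Rightarrow> nat \<Rightarrow> nat \<Rightarrow> bool" where
  "is_gram k a b c \<longleftrightarrow> (\<exists>u v :: nat \<Rightarrow> nat.
     (\<Sum>i<k. (u i)\<^sup>2) = a \<and> (\<Sum>i<k. u i * v i) = b \<and> (\<Sum>i<k. (v i)\<^sup>2) = c)"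

lemma is_gram_swap: "is_gram k a b c \<Longrightarrow> is_gram k c b a"
  unfolding is_gram_def by (subst mult.commute) blast

lemma is_gram_0: "is_gram 0 0 0 0"
  by (simp add: is_gram_def)

lemma is_gram_Suc:
  assumes "is_gram k a b c"
  shows "is_gram (Suc k) (a + x\<^sup>2) (b + x * y) (c + y\<^sup>2)"
proof -
  from assms obtain u v where "(\<Sum>i<k. (u i)\<^sup>2) = a" "(\<Sum>i<k. u i * v i) = b" "(\<Sum>i<k. (v i)\<^sup>2) = c"
    unfolding is_gram_def by blast
  then show ?thesis unfolding is_gram_def
    by (intro exI[of _ "u(k := x)"] exI[of _ "v(k := y)"]) simp
qed

text \<open>Undoes the replacement of \<open>v\<close> by \<open>v - u\<close>.\<close>

lemma is_gram_add:
  assumes "is_gram k a b c"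
  shows "is_gram k a (b + a) (c + 2 * b + a)"
proof -
  from assms obtain u v where "(\<Sum>i<k. (u i)\<^sup>2) = a" "(\<Sum>i<k. u i * v i) = b" "(\<Sum>i<k. (v i)\<^sup>2) = c"
    unfolding is_gram_def by blast
  moreover have "(\<Sum>i<k. u i * (v i + u i)) = (\<Sum>i<k. u i * v i) + (\<Sum>i<k. (u i)\<^sup>2)"
    by (simp add: distrib_left sum.distrib power2_eq_square)
  moreover have "(\<Sum>i<k. (v i + u i)\<^sup>2) = (\<Sum>i<k. (v i)\<^sup>2) + 2 * (\<Sum>i<k. u i * v i) + (\<Sum>i<k. (u i)\<^sup>2)"
    by (simp add: power2_sum sum.distrib sum_distrib_left mult_ac)
  ultimately show ?thesis unfolding is_gram_def
    by (intro exI[of _ u] exI[of _ "\<lambda>i. v i + u i"]) simp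
qed

lemma is_gram_add_four_squares:
  assumes "is_gram k a b d" "d \<le> c"
  shows "is_gram (k + 4) a b c"
proof -
  obtain w x y z :: nat where "c - d = w\<^sup>2 + x\<^sup>2 + y\<^sup>2 + z\<^sup>2" by (rule lagrange_four_squares)
  then have "c = d + w\<^sup>2 + x\<^sup>2 + y\<^sup>2 + z\<^sup>2" using assms(2) by simp
  moreover have "is_gram (Suc (Suc (Suc (Suc k)))) a b (d + w\<^sup>2 + x\<^sup>2 + y\<^sup>2 + z\<^sup>2)"
    \<comment> \<open>The zeros are the new coordinates of \<open>u\<close>, so \<open>a\<close> and
      \<open>b\<close> stay unchanged.\<close>
    using is_gram_Suc[OF is_gram_Suc[OF is_gram_Suc[OF is_gram_Suc[OF assms(1)]]], of 0 0 0 0 w x y z]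
    by simp
  ultimately show ?thesis by (simp add: eval_nat_numeral)
qed

section \<open>Greedy payment with coins\<close>

text \<open>The bound lets the tail, worth the sum of its squares, cover every remainder below
  \<open>x\<close>.\<close>

fun complete_coins :: "nat list \<Rightarrow> bool" where
  "complete_coins [] \<longleftrightarrow> True"
| "complete_coins (x # xs) \<longleftrightarrow> x \<le> (\<Sum>y\<leftarrow>xs. y\<^sup>2) + 1 \<and> complete_coins xs"

text \<open>Think of the entries of \<open>xs\<close> as coins, \<open>x\<close> copies of each coin \<open>x\<close>.  Every amount \<open>b\<close> up to the total
  is paid greedily; the numbers of coins used form a vector dominated by \<open>xs\<close>.\<close>

lemma complete_coins_is_gram:
  assumes "complete_coins xs" "b \<le> (\<Sum>x\<leftarrow>xs. x\<^sup>2)"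
  shows "\<exists>d\<le>(\<Sum>x\<leftarrow>xs. x\<^sup>2). is_gram (length xs) (\<Sum>x\<leftarrow>xs. x\<^sup>2) b d"
  using assms
proof (induction xs arbitrary: b)
  case Nil
  then show ?case using is_gram_0 by auto
next
  case (Cons x xs)
  let ?s = "\<Sum>y\<leftarrow>xs. y\<^sup>2"
  define q where "q = min x (b div x)"
  have "b div x * x \<le> b" by simp
  then have qb: "q * x \<le> b" unfolding q_def by (metis le_trans min.cobounded2 mult_le_mono1)
  \<comment> \<open>Either all \<open>x\<close> copies are spent and the bound on \<open>b\<close>
    suffices, or the remainder is below \<open>x\<close> and completeness applies.\<close>
  have "b - q * x \<le> ?s"
  proof (cases "x = 0 \<or> x \<le> b div x")
    case True
    then show ?thesis using Cons.prems unfolding q_def by (auto simp: power2_eq_square min_def)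
  next
    case False
    then have "b - q * x = b mod x" unfolding q_def by (simp add: min_def minus_div_mult_eq_mod)
    also have "\<dots> < x" using False by simp
    finally show ?thesis using Cons.prems by simp
  qed
  then obtain d where d: "d \<le> ?s" "is_gram (length xs) ?s (b - q * x) d"
    using Cons by auto
  have "is_gram (length (x # xs)) (\<Sum>y\<leftarrow>x # xs. y\<^sup>2) b (d + q\<^sup>2)"
    using is_gram_Suc[OF d(2), of x q] qb by (simp add: mult.commute add.commute)
  moreover have "d + q\<^sup>2 \<le> (\<Sum>y\<leftarrow>x # xs. y\<^sup>2)"
    using add_mono[OF d(1) power_mono[of q x 2]] by (simp add: q_def add.commute)
  ultimately show ?case by blast
qed

lemma complete_coins_exist:
  assumes "a \<le> 64" "a \<noteq> 33"
  shows "\<exists>xs. complete_coins xs \<and> length xs = 5 \<and> (\<Sum>x\<leftarrow>xs. x\<^sup>2) = a"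
proof -
  obtain xss :: "nat list list"
    where sums: "map (\<lambda>xs. \<Sum>x\<leftarrow>xs. x\<^sup>2) xss = [0..<33] @ [34..<65]"
      and coins: "list_all (\<lambda>xs. complete_coins xs \<and> length xs = 5) xss"
  proof
    \<comment> \<open>One list for each total in increasing order, skipping 33; larger coins come
      first and zeros pad to length five.\<close>
    let ?xss = "[[0,0,0,0,0], [1,0,0,0,0], [1,1,0,0,0], [1,1,1,0,0], [1,1,1,1,0], [2,1,0,0,0], [2,1,1,0,0],
     [2,1,1,1,0], [2,1,1,1,1], [2,2,1,0,0], [2,2,1,1,0], [3,1,1,0,0], [3,1,1,1,0], [3,1,1,1,1],
     [3,2,1,0,0], [3,2,1,1,0], [3,2,1,1,1], [2,2,2,2,1], [3,2,2,1,0], [4,1,1,1,0], [4,1,1,1,1],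
     [4,2,1,0,0], [4,2,1,1,0], [4,2,1,1,1], [3,3,2,1,1], [4,2,2,1,0], [4,2,2,1,1], [4,3,1,1,0],
     [4,3,1,1,1], [5,1,1,1,1], [5,2,1,0,0], [5,2,1,1,0], [5,2,1,1,1], [5,2,2,1,0], [5,2,2,1,1],
     [5,3,1,1,0], [5,3,1,1,1], [5,2,2,2,1], [5,3,2,1,0], [5,3,2,1,1], [6,2,1,0,0], [6,2,1,1,0],
     [6,2,1,1,1], [5,4,1,1,1], [6,2,2,1,0], [6,2,2,1,1], [6,3,1,1,0], [6,3,1,1,1], [6,2,2,2,1],
     [6,3,2,1,0], [6,3,2,1,1], [5,4,3,1,1], [4,4,4,2,1], [6,3,2,2,1], [7,2,1,1,0], [7,2,1,1,1],
     [6,4,2,1,0], [7,2,2,1,0], [7,2,2,1,1], [7,3,1,1,0], [7,3,1,1,1], [7,2,2,2,1], [7,3,2,1,0],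
     [7,3,2,1,1]]"
    show "map (\<lambda>xs. \<Sum>x\<leftarrow>xs. x\<^sup>2) ?xss = [0..<33] @ [34..<65]"
      by (simp add: upt_rec)
    show "list_all (\<lambda>xs. complete_coins xs \<and> length xs = 5) ?xss"
      by simp
  qed
  have "a \<in> set (map (\<lambda>xs. \<Sum>x\<leftarrow>xs. x\<^sup>2) xss)"
    unfolding sums set_append set_upt using assms by auto
  then show ?thesis using coins unfolding list_all_iff by auto
qed

text \<open>The number 33 has no complete system of five coins.  The vector \<open>(4, 4, 1, 0, 0)\<close> still works
  except for \<open>b = 31\<close>, where \<open>(5, 2, 2, 0, 0)\<close> is used.\<close>

lemma is_gram_33:
  assumes "b < 33"
  shows "\<exists>d\<le>33. is_gram 5 33 b d"
proof (cases "b = 31")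
  case True
  \<comment> \<open>Here \<open>v\<close> is (5, 2, 1, 0, 0): 25 + 4 + 2 = 31 and 25 + 4 + 1 =
    30.\<close>
  have "is_gram (Suc (Suc (Suc (Suc (Suc 0))))) 33 31 30"
    using is_gram_Suc[OF is_gram_Suc[OF is_gram_Suc[OF is_gram_Suc[OF is_gram_Suc[OF is_gram_0]]]],
        of 0 0 2 2 5 0 0 1 2 5] by simp
  then show ?thesis unfolding True by (intro exI[of _ 30]) (simp add: eval_nat_numeral)
next
  case False
  \<comment> \<open>The quotient by 4 is split evenly between the two entries 4 to keep the squares
    small. As \<open>r\<close> may exceed the entry 1 of \<open>u\<close>, the bound is checked for
    each \<open>b\<close>; at 31 it fails with 9 + 16 + 9 = 34.\<close>
  define p q r where "p = b div 4 div 2" and "q = b div 4 - b div 4 div 2" and "r = b mod 4"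
  have "is_gram (Suc (Suc (Suc (Suc (Suc 0))))) 33 (r + 4 * q + 4 * p) (r\<^sup>2 + q\<^sup>2 + p\<^sup>2)"
    using is_gram_Suc[OF is_gram_Suc[OF is_gram_Suc[OF is_gram_Suc[OF is_gram_Suc[OF is_gram_0]]]],
        of 0 0 1 4 4 0 0 r q p] by simp
  moreover have "r + 4 * q + 4 * p = r + 4 * (b div 4)" unfolding p_def q_def by simp
  then have "r + 4 * q + 4 * p = b" unfolding r_def by simp
  moreover have "\<forall>b\<in>set [0..<33]. b \<noteq> 31 \<longrightarrow> (b mod 4)\<^sup>2 + (b div 4 - b div 4 div 2)\<^sup>2 + (b div 4 div 2)\<^sup>2 \<le> 33"
    by (simp add: upt_rec power2_eq_square)
  then have "r\<^sup>2 + q\<^sup>2 + p\<^sup>2 \<le> 33" using assms False unfolding p_def q_def r_def by auto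
  ultimately show ?thesis by (auto simp: eval_nat_numeral)
qed

lemma is_gram_5:
  assumes "b < a" "a \<le> 64"
  shows "\<exists>d\<le>a. is_gram 5 a b d"
proof (cases "a = 33")
  case True
  then show ?thesis using is_gram_33 assms by simp
next
  case False
  then obtain xs where "complete_coins xs" "length xs = 5" "(\<Sum>x\<leftarrow>xs. x\<^sup>2) = a"
    using complete_coins_exist assms by blast
  then show ?thesis using complete_coins_is_gram[of xs b] assms by simp
qed

section \<open>Reduction of binary quadratic forms\<close>

text \<open>Gauss reduction by induction on the trace. The disjunction makes the hypotheses
  symmetric, so they survive swapping the rows.\<close>

lemma is_gram_9:
  assumes "b\<^sup>2 \<le> a * c" "a \<le> 64 \<or> c \<le> 64"
  shows "is_gram 9 a b c"
  using assms
proof (induction "a + c" arbitrary: a b c rule: less_induct)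
  case less
  \<comment> \<open>Stated with its own induction hypothesis, so that it serves both orders of the
    diagonal entries.\<close>
  have reduced: "is_gram 9 a b c"
    if "a \<le> c" and psd: "b\<^sup>2 \<le> a * c" and bound: "a \<le> 64"
      and IH: "\<And>b' c'. c' < c \<Longrightarrow> b'\<^sup>2 \<le> a * c' \<Longrightarrow> is_gram 9 a b' c'" for a b c
  proof -
    consider "b < a" | "a = 0" | "0 < a" "a \<le> b" by linarith
    then show ?thesis
    proof cases
      case 1
      then obtain d where "d \<le> a" "is_gram 5 a b d" using is_gram_5 bound by blast
      then have "is_gram (5 + 4) a b c"
        using \<open>a \<le> c\<close> by (intro is_gram_add_four_squares[of 5 a b d]) simp_all
      then show ?thesis by simp
    next
      case 2
      have "is_gram 5 0 0 0"
        using complete_coins_is_gram[of "[0, 0, 0, 0, 0]" 0] by (simp add: eval_nat_numeral)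
      then have "is_gram (5 + 4) 0 0 c" by (rule is_gram_add_four_squares) simp
      then show ?thesis using 2 psd by simp
    next
      case 3
      \<comment> \<open>From \<open>4 * b^2 <= 4 * a * c <= (a + c)^2\<close>; it makes the
        truncated subtraction in \<open>c'\<close> exact.\<close>
      have "2 * b \<le> c + a"
      proof (rule power2_le_imp_le)
        have "int (4 * (a * c)) \<le> int ((c + a)\<^sup>2)"
          using zero_le_power2[of "int a - int c"] by (simp add: power2_eq_square algebra_simps)
        then have "4 * (a * c) \<le> (c + a)\<^sup>2" by (simp only: of_nat_le_iff)
        then show "(2 * b)\<^sup>2 \<le> (c + a)\<^sup>2" using psd by (simp add: power_mult_distrib)
      qed simp
      define b' c' where "b' = b - a" and "c' = c + a - 2 * b"
      have b: "b = b' + a" and c: "c = c' + 2 * b' + a"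
        unfolding b'_def c'_def using 3 \<open>2 * b \<le> c + a\<close> by auto
      \<comment> \<open>The substitution preserves the determinant:
        \<open>a * c' - b'^2 = a * c - b^2\<close>.\<close>
      have "b'\<^sup>2 \<le> a * c'" using psd unfolding b c by (simp add: power2_eq_square algebra_simps)
      then have "is_gram 9 a b' c'" using 3 c by (intro IH) auto
      then show ?thesis unfolding b c by (rule is_gram_add)
    qed
  qed
  show ?case
  proof (cases "a \<le> c")
    case True
    then show ?thesis
    proof (rule reduced)
      show "is_gram 9 a b' c'" if "c' < c" "b'\<^sup>2 \<le> a * c'" for b' c'
        using that less.prems True by (intro less.hyps) linarith+
    qed (use less.prems True in linarith)+
  next
    case False
    then have "c \<le> a" "c \<le> 64" using less.prems by linarith+
    from this(1) have "is_gram 9 c b a"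
    proof (rule reduced)
      show "b\<^sup>2 \<le> c * a" using less.prems by (simp add: mult.commute)
      show "is_gram 9 c b' a'" if "a' < a" "b'\<^sup>2 \<le> c * a'" for b' a'
        using that \<open>c \<le> 64\<close>
        by (intro is_gram_swap[OF less.hyps]) (simp_all add: mult.commute)
    qed fact
    then show ?thesis by (rule is_gram_swap)
  qed
qed

section \<open>From real matrices to natural numbers and back\<close>

theorem theorem6:
  fixes a b c :: real and A :: "real ^ 2 ^ 2"
  assumes "A = vector [vector [a, b], vector [b, c]]"
    and "doubly_nonnegative A"
    and "nonneg_integer_matrix A"
    and "a \<le> 64"
  shows "\<exists>B :: real ^ 9 ^ 2. nonneg_integer_matrix B \<and> A = B ** transpose B"
proof -
  have A: "A $ 1 $ 1 = a" "A $ 1 $ 2 = b" "A $ 2 $ 1 = b" "A $ 2 $ 2 = c"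
    by (simp_all add: assms(1))
  have "a \<in> \<nat>" "b \<in> \<nat>" "c \<in> \<nat>"
    using assms(3) A unfolding nonneg_integer_matrix_def by metis+
  then obtain a' b' c' where nat: "a = real a'" "b = real b'" "c = real c'"
    by (auto elim!: Nats_cases)
  have form: "0 \<le> x * (a * x + b * y) + y * (b * x + c * y)" for x y
  proof -
    have "0 \<le> vector [x, y] \<bullet> (A *v vector [x, y])"
      using assms(2) unfolding doubly_nonnegative_def positive_semidefinite_def by blast
    then show ?thesis
      by (simp add: inner_vec_def matrix_vector_mult_def sum_2 A)
  qed
  \<comment> \<open>For \<open>a > 0\<close> the form at \<open>(-b, a)\<close> is \<open>a\<close>
    times the determinant. For \<open>a = 0\<close> and \<open>b >= 1\<close> its value at
    \<open>(-(c + 1), 1)\<close> would be negative.\<close>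
  have "b\<^sup>2 \<le> a * c"
  proof (cases "a = 0")
    case True
    have "b = 0"
    proof (rule ccontr)
      assume "b \<noteq> 0"
      then have "1 * (c + 1) \<le> b * (c + 1)" using nat by (intro mult_right_mono) auto
      then show False using form[of "- (c + 1)" 1] True nat by (simp add: algebra_simps)
    qed
    then show ?thesis using True by simp
  next
    case False
    have "0 \<le> a * (a * c - b\<^sup>2)"
      using form[of "- b" a] by (simp add: power2_eq_square algebra_simps)
    then show ?thesis using False nat by (simp add: zero_le_mult_iff)
  qed
  then have "real (b'\<^sup>2) \<le> real (a' * c')" by (simp add: nat)
  then have "b'\<^sup>2 \<le> a' * c'" by (simp only: of_nat_le_iff)
  moreover have "a' \<le> 64" using assms(4) nat by simp
  ultimately have "is_gram 9 a' b' c'" using is_gram_9 by blast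
  then obtain u v :: "nat \<Rightarrow> nat" where uv: "(\<Sum>i<9. (u i)\<^sup>2) = a'" "(\<Sum>i<9. u i * v i) = b'"
      "(\<Sum>i<9. (v i)\<^sup>2) = c'"
    unfolding is_gram_def by blast
  \<comment> \<open>Any enumeration of the index type will do, since only sums over all coordinates
    matter.\<close>
  obtain h :: "9 \<Rightarrow> nat" where h: "bij_betw h UNIV {..<9}"
    using ex_bij_betw_finite_nat[of "UNIV :: 9 set"] by (auto simp: atLeast0LessThan)
  have reindex: "(\<Sum>k\<in>UNIV. real (f (h k)) * real (g (h k))) = real (\<Sum>i<9. f i * g i)" for f g
    using sum.reindex_bij_betw[OF h, of "\<lambda>i. real (f i) * real (g i)"] by simp
  define B :: "real ^ 9 ^ 2" where "B = (\<chi> i k. real ((if i = 1 then u else v) (h k)))"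
  have "nonneg_integer_matrix B"
    unfolding nonneg_integer_matrix_def B_def by simp
  moreover have "A = B ** transpose B"
    unfolding vec_eq_iff forall_2 A nat uv(1)[symmetric] uv(2)[symmetric] uv(3)[symmetric]
    by (simp add: matrix_matrix_mult_def transpose_def B_def reindex power2_eq_square mult.commute
        del: of_nat_sum of_nat_mult)
  ultimately show ?thesis by blast
qed

end
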